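(* Let $n,k$ be positive integers, let $1<c<1+\frac{1}{4k}$, let $B$ be the block size and $1\le\alpha\le B$. For sufficiently large dimension $d=O(k\log(n/k))$, any indexing scheme for $(c,k)$-NN on $n$-point sets in $d$-dimensional Hamming space $\{0,1\}^d$ whose worst-case query time is $\lceil k/\alpha\rceil$ I/Os must, for some $n$-point set $P$, use $\Omega\!\left(\left(\frac{1}{2e}\sqrt{\frac{n\alpha}{kB}}\right)^{\alpha}\right)$ blocks of space.
   Context: Hamming distance on $\{0,1\}^d$: number of coordinates in which two vectors differ. $(c,k)$-NN problem: given a metric space, a set $P$ with $|P|=n$, an integer $1\le k\le n$ and $c>1$, a query $q$ must be answered by a set of $k$ points of $P$, each at distance at most $c$ times the distance from $q$ to its $k$-th nearest neighbor in $P$. Indexing scheme (indexability model): for a point set $P$ and block size $B$, a collection $\mathcal{B}$ of blocks, each a subset of $P$ of at most $B$ points, possibly depending on $c,k$; space usage is $|\mathcal{B}|$; the query time for $q$ is the minimum number of blocks whose union contains a valid answer to $q$; worst-case query time is the maximum over all queries $q\in\{0,1\}^d$.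
   Formalization: The formal theorem adds α ≤ 2k (for α > 2k the claim is false, e.g. k = 1, α = B = 3, where ⌈n/3⌉ blocks suffice) and reads log(n/k) in the dimension bound as max(1, log₂(n/k)), since for n = k > 1 the literal bound gives d = 0. *)

theory Defs
  imports Complex_Main "HOL-Library.Multiset" "HOL-Library.Extended_Nat"
begin

(* {0,1}^d is encoded by the Boolean lists of length d, because d has to be quantified
   inside the statement. *)
definition cube :: "nat \<Rightarrow> bool list set" where
  "cube d = {x. length x = d}"

(* Only meaningful for lists of equal length. *)
definition hamming :: "bool list \<Rightarrow> bool list \<Rightarrow> real" where
  "hamming x y = real (card {i. i < length x \<and> x ! i \<noteq> y ! i})"

(* The k-th smallest entry of the list of distances from q to the points of P, counted with
   multiplicity; meaningful for finite P and 1 <= k <= card P. *)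
definition kth_nn_dist :: "('a \<Rightarrow> 'a \<Rightarrow> real) \<Rightarrow> nat \<Rightarrow> 'a set \<Rightarrow> 'a \<Rightarrow> real" where
  "kth_nn_dist \<delta> k P q =
     sorted_list_of_multiset (image_mset (\<lambda>p. \<delta> q p) (mset_set P)) ! (k - 1)"

definition nn_answer ::
  "('a \<Rightarrow> 'a \<Rightarrow> real) \<Rightarrow> real \<Rightarrow> nat \<Rightarrow> 'a set \<Rightarrow> 'a \<Rightarrow> 'a set \<Rightarrow> bool" where
  "nn_answer \<delta> c k P q A \<longleftrightarrow>
     A \<subseteq> P \<and> card A = k \<and> (\<forall>a\<in>A. \<delta> q a \<le> c * kth_nn_dist \<delta> k P q)"

definition block_collection :: "nat \<Rightarrow> 'a set \<Rightarrow> 'a set set \<Rightarrow> bool" where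
  "block_collection B P \<B> \<longleftrightarrow> (\<forall>b\<in>\<B>. b \<subseteq> P \<and> card b \<le> B)"

(* The infimum is attained unless no subcollection covers a valid answer, in which case
   it is \<infinity>. *)
definition query_time ::
  "('a \<Rightarrow> 'a \<Rightarrow> real) \<Rightarrow> real \<Rightarrow> nat \<Rightarrow> 'a set \<Rightarrow> 'a set set \<Rightarrow> 'a \<Rightarrow> enat" where
  "query_time \<delta> c k P \<B> q =
     Inf {enat (card S) | S. S \<subseteq> \<B> \<and> finite S \<and> (\<exists>A. nn_answer \<delta> c k P q A \<and> A \<subseteq> \<Union> S)}"

definition worst_query_time ::
  "('a \<Rightarrow> 'a \<Rightarrow> real) \<Rightarrow> 'a set \<Rightarrow> real \<Rightarrow> nat \<Rightarrow> 'a set \<Rightarrow> 'a set set \<Rightarrow> enat" where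
  "worst_query_time \<delta> Q c k P \<B> = (SUP q\<in>Q. query_time \<delta> c k P \<B> q)"

definition point_sets :: "nat \<Rightarrow> nat \<Rightarrow> bool list set set" where
  "point_sets n d = {P. P \<subseteq> cube d \<and> card P = n}"

(* An indexing scheme assigns a block collection to every n-point set P; the same time
   bound t has to hold for all P and all queries. *)
definition hamming_indexing_scheme ::
  "nat \<Rightarrow> nat \<Rightarrow> real \<Rightarrow> nat \<Rightarrow> nat \<Rightarrow> nat \<Rightarrow> (bool list set \<Rightarrow> bool list set set) \<Rightarrow> bool" where
  "hamming_indexing_scheme n d c k B t I \<longleftrightarrow>
     (\<forall>P\<in>point_sets n d. block_collection B P (I P) \<and>
        worst_query_time hamming (cube d) c k P (I P) \<le> enat t)"

end

theory Submission imports Defs "HOL-Analysis.Convex" "HOL-Library.FuncSet" begin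

text \<open>
  Split the coordinates into \<open>k\<close> segments of length \<open>O(log (n/k))\<close> and take a constant-weight code
  of about \<open>n/k\<close> words and linear minimum distance for one segment (Gilbert-Varshamov). The point
  set consists of \<open>k\<close> groups: the points of group \<open>i\<close> carry a codeword in segment \<open>i\<close> and are zero
  elsewhere. The query that concatenates one codeword per segment has the corresponding
  transversal of the groups as its only valid answer, as all other points are farther by a factor
  of at least \<open>1 + 1/(4k)\<close>. By AM-GM, \<open>t\<close> blocks contain at most \<open>(t B / k)^k\<close> transversals, so
  \<open>M\<close> blocks with query time \<open>t\<close> cover at most \<open>M^t (t B / k)^k\<close> of them, while there are at
  least \<open>\<lfloor>n/k\<rfloor>^k\<close>.
\<close>

section \<open>Binary codes with large minimum distance\<close>

text \<open>Chernoff-style: weight each subset \<open>X\<close> by \<open>2\<close> to the size of its complement; the total weight is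
  \<open>3^(8 s) = 6561^s\<close>.\<close>
lemma card_small_subsets:
  "card {X. X \<subseteq> {..<8 * s} \<and> card X < 2 * s} * 64 ^ s \<le> (6561::nat) ^ s"
proof -
  let ?U = "{..<8 * s}"
  let ?V = "{X. X \<subseteq> ?U \<and> card X < 2 * s}"
  have "card ?V * 64 ^ s = (\<Sum>X\<in>?V. 64 ^ s)"
    by simp
  also have "\<dots> \<le> (\<Sum>X\<in>?V. (2::nat) ^ card (?U - X))"
  proof (rule sum_mono)
    fix X assume "X \<in> ?V"
    then have X: "X \<subseteq> ?U" "card X < 2 * s" by auto
    then have "card (?U - X) = 8 * s - card X"
      by (simp add: card_Diff_subset finite_subset)
    then have "6 * s \<le> card (?U - X)"
      using X by simp
    then have "(2::nat) ^ (6 * s) \<le> 2 ^ card (?U - X)"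
      by (rule power_increasing) simp
    then show "64 ^ s \<le> (2::nat) ^ card (?U - X)"
      by (simp add: power_mult)
  qed
  also have "\<dots> \<le> (\<Sum>X\<in>Pow ?U. (2::nat) ^ card (?U - X))"
    by (rule sum_mono2) auto
  also have "\<dots> = (\<Prod>x\<in>?U. 1 + 2)"
    by (subst prod_add) (simp_all only: finite_lessThan prod_constant power_one mult_1)
  also have "\<dots> = 3 ^ (8 * s)" by (simp add: numeral_3_eq_3)
  also have "\<dots> = 6561 ^ s" by (simp only: power_mult) simp
  finally show ?thesis .
qed

text \<open>Gilbert-Varshamov: while the balls around the chosen words do not fill
  \<open>Pow U\<close>, a further word can be added. Each ball is a translate, by symmetric
  difference, of the ball around the empty set, which bounds its size.\<close>

lemma greedy_code:
  assumes "finite U" and "N * card {X. X \<subseteq> U \<and> card X < r} \<le> 2 ^ card U"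
  shows "\<exists>W. \<forall>j<N. W j \<subseteq> U \<and> (\<forall>j'<j. r \<le> card (sym_diff (W j) (W j')))"
  using assms(2)
proof (induction N)
  case 0
  show ?case by simp
next
  case (Suc N)
  let ?V = "{X. X \<subseteq> U \<and> card X < r}"
  show ?case
  proof (cases "r = 0")
    case True
    then show ?thesis by auto
  next
    case False
    \<comment> \<open>For \<open>r > 0\<close> the ball contains the empty set, so the room reserved
      for word \<open>N\<close> makes the union bound below strict.\<close>
    have "finite ?V" using \<open>finite U\<close> by simp
    moreover have "{} \<in> ?V" using False by simp
    ultimately have pos: "card ?V > 0" by (metis card_gt_0_iff empty_iff)
    from Suc obtain W where W: "\<And>j. j < N \<Longrightarrow> W j \<subseteq> U"
      "\<And>j j'. j < N \<Longrightarrow> j' < j \<Longrightarrow> r \<le> card (sym_diff (W j) (W j'))"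
      by auto
    let ?ball = "\<lambda>j. (\<lambda>X. sym_diff X (W j)) ` ?V"
    have "card (\<Union>j<N. ?ball j) \<le> (\<Sum>j<N. card (?ball j))"
      by (rule card_UN_le) simp
    also have "\<dots> \<le> (\<Sum>j<N. card ?V)"
      by (intro sum_mono card_image_le \<open>finite ?V\<close>)
    also have "\<dots> < 2 ^ card U"
      using Suc.prems pos by simp
    finally have "card (\<Union>j<N. ?ball j) < card (Pow U)"
      using \<open>finite U\<close> by (simp add: card_Pow)
    then have "\<not> Pow U \<subseteq> (\<Union>j<N. ?ball j)"
      using \<open>finite ?V\<close> by (metis (no_types, lifting) card_mono finite_UN finite_imageI finite_lessThan not_le)
    then obtain Y where "Y \<in> Pow U" "Y \<notin> (\<Union>j<N. ?ball j)"
      by (meson subsetI)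
    then have Y: "Y \<subseteq> U" "\<And>j. j < N \<Longrightarrow> Y \<notin> ?ball j"
      by (simp_all only: Pow_iff UN_iff lessThan_iff bex_simps) metis
    have far: "r \<le> card (sym_diff Y (W j))" if "j < N" for j
    proof (rule ccontr)
      assume "\<not> ?thesis"
      then have "sym_diff Y (W j) \<in> ?V" using Y W(1)[OF that] by auto
      \<comment> \<open>Translation by \<open>W j\<close> is an involution, so closeness to
        \<open>W j\<close> would put \<open>Y\<close> into its ball.\<close>
      moreover have "Y = sym_diff (sym_diff Y (W j)) (W j)" by auto
      ultimately show False using Y(2)[OF that] by (metis (no_types, lifting) image_eqI)
    qed
    show ?thesis
      by (rule exI[of _ "W(N := Y)"]) (use W Y(1) far in \<open>auto simp: less_Suc_eq\<close>)
  qed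
qed

text \<open>Equal weights matter because in each segment where a point is zero, its distance to the
  query is the weight of the query's codeword; this must not depend on the codeword.\<close>

lemma constant_weight_code:
  obtains E :: "nat \<Rightarrow> nat set" where
    "\<And>j. j < 2 ^ s \<Longrightarrow> E j \<subseteq> {..<16 * s}"
    "\<And>j. j < 2 ^ s \<Longrightarrow> card (E j) = 8 * s"
    "\<And>i j. i < 2 ^ s \<Longrightarrow> j < 2 ^ s \<Longrightarrow> i \<noteq> j \<Longrightarrow> 2 * s \<le> card (sym_diff (E i) (E j))"
proof -
  let ?U = "{..<8 * s}"
  let ?V = "card {X. X \<subseteq> ?U \<and> card X < 2 * s}"
  \<comment> \<open>The count of small sets leaves room for \<open>2 ^ s\<close> words, as
    \<open>2 * 6561 = 13122\<close> is below \<open>16384 = 2 ^ 8 * 64\<close>.\<close>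
  have "(2 ^ s * ?V) * 64 ^ s \<le> 2 ^ s * 6561 ^ s"
    using card_small_subsets[of s] by simp
  also have "\<dots> = 13122 ^ s" by (simp flip: power_mult_distrib)
  also have "\<dots> \<le> (16384::nat) ^ s" by (rule power_mono) auto
  also have "\<dots> = 2 ^ (8 * s) * 64 ^ s" by (simp add: power_mult flip: power_mult_distrib)
  finally have "2 ^ s * ?V \<le> 2 ^ card ?U" by simp
  then obtain W where W: "\<And>j. j < (2::nat) ^ s \<Longrightarrow> W j \<subseteq> ?U"
    "\<And>j j'. j < 2 ^ s \<Longrightarrow> j' < j \<Longrightarrow> 2 * s \<le> card (sym_diff (W j) (W j'))"
    using greedy_code[of ?U "2 ^ s" "2 * s"] by auto
  have W': "2 * s \<le> card (sym_diff (W i) (W j))" if "i < 2 ^ s" "j < 2 ^ s" "i \<noteq> j" for i j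
  proof (cases "j < i")
    case True
    then show ?thesis using W(2) that by auto
  next
    case False
    then show ?thesis using W(2)[of j i] that by (simp add: Un_commute)
  qed
  \<comment> \<open>Replacing the bit 1 by 10 and the bit 0 by 01 makes the weight constant.\<close>
  define E where "E j = (\<lambda>x. if x \<in> W j then 2 * x else 2 * x + 1) ` ?U" for j
  show thesis
  proof (rule that[of E])
    fix j :: nat assume "j < 2 ^ s"
    show "E j \<subseteq> {..<16 * s}" unfolding E_def by auto
    have "inj_on (\<lambda>x. if x \<in> W j then 2 * x else 2 * x + 1) ?U"
      by (rule inj_onI) (auto split: if_splits; presburger)
    then show "card (E j) = 8 * s" unfolding E_def by (subst card_image) simp_all
  next
    fix i j :: nat assume ij: "i < 2 ^ s" "j < 2 ^ s" "i \<noteq> j"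
    \<comment> \<open>The even positions of \<open>E l\<close> are a copy of \<open>W l\<close>, so
      they alone retain the distance.\<close>
    have mem: "2 * x \<in> E l \<longleftrightarrow> x \<in> W l" if "l < 2 ^ s" for l x
      using W(1)[OF that] unfolding E_def by (auto split: if_splits; presburger)
    have "(*) 2 ` sym_diff (W i) (W j) \<subseteq> sym_diff (E i) (E j)"
      using mem ij by auto
    moreover have "finite (sym_diff (E i) (E j))" unfolding E_def by simp
    ultimately have "card ((*) 2 ` sym_diff (W i) (W j)) \<le> card (sym_diff (E i) (E j))"
      by (rule card_mono[rotated])
    moreover have "card ((*) 2 ` sym_diff (W i) (W j)) = card (sym_diff (W i) (W j))"
      by (rule card_image) (simp add: inj_on_def)
    ultimately show "2 * s \<le> card (sym_diff (E i) (E j))"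
      using W'[OF ij] by simp
  qed
qed

section \<open>Codewords as segments of vectors in the cube\<close>

text \<open>The pair \<open>(i, x)\<close> stands for position \<open>x\<close> of the \<open>i\<close>-th segment of length \<open>D\<close>. Coordinates beyond
  the segments used by \<open>T\<close> are zero, which pads the words to every larger dimension.\<close>
definition segment_word :: "nat \<Rightarrow> nat \<Rightarrow> (nat \<times> nat) set \<Rightarrow> bool list" where
  "segment_word d D T = map (\<lambda>x. (x div D, x mod D) \<in> T) [0..<d]"

lemma segment_word_in_cube: "segment_word d D T \<in> cube d"
  by (simp add: segment_word_def cube_def)

lemma hamming_segment_word:
  assumes "T \<subseteq> {..<k} \<times> {..<D}" "T' \<subseteq> {..<k} \<times> {..<D}" "k * D \<le> d"
  shows "hamming (segment_word d D T) (segment_word d D T') = real (card (sym_diff T T'))"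
proof -
  \<comment> \<open>Division with remainder by \<open>D\<close> inverts \<open>?h\<close> on the
    box, whose second components stay below \<open>D\<close>; \<open>k * D \<le> d\<close> keeps the
    values of \<open>?h\<close> inside the word.\<close>
  let ?h = "\<lambda>(i, x). i * D + x"
  have "{i. i < length (segment_word d D T) \<and> segment_word d D T ! i \<noteq> segment_word d D T' ! i}
      = {y. y < d \<and> (y div D, y mod D) \<in> sym_diff T T'}"
    by (auto simp: segment_word_def)
  also have "\<dots> = ?h ` sym_diff T T'"
  proof (intro equalityI subsetI)
    fix y assume "y \<in> {y. y < d \<and> (y div D, y mod D) \<in> sym_diff T T'}"
    then show "y \<in> ?h ` sym_diff T T'"
      by (intro image_eqI[of _ _ "(y div D, y mod D)"]) auto
  next
    fix y assume "y \<in> ?h ` sym_diff T T'"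
    then obtain i x where ix: "(i, x) \<in> sym_diff T T'" "y = i * D + x" by auto
    then have *: "i < k" "x < D" using assms by auto
    then have "y < Suc i * D" using ix by simp
    also have "\<dots> \<le> k * D" using * by (intro mult_right_mono) auto
    finally have "y < d" using assms by simp
    moreover have "y div D = i" "y mod D = x" using * ix by auto
    ultimately show "y \<in> {y. y < d \<and> (y div D, y mod D) \<in> sym_diff T T'}" using ix by auto
  qed
  finally have "{i. i < length (segment_word d D T) \<and> segment_word d D T ! i \<noteq> segment_word d D T' ! i}
      = ?h ` sym_diff T T'" .
  moreover have "inj_on ?h (sym_diff T T')"
  proof (rule inj_onI, clarify)
    fix i x i' x' assume a: "(i, x) \<in> sym_diff T T'" "(i', x') \<in> sym_diff T T'" "i * D + x = i' * D + x'"
    then have "x < D" "x' < D" using assms by auto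
    then have "(i * D + x) div D = i" "(i * D + x) mod D = x"
      "(i' * D + x') div D = i'" "(i' * D + x') mod D = x'" by auto
    then show "i = i' \<and> x = x'" using a(3) by metis
  qed
  ultimately show ?thesis by (simp add: hamming_def card_image)
qed

section \<open>Nearest neighbours and query times\<close>

text \<open>The \<open>k\<close> points at distance \<open>r\<close> can be placed first in the
  sorted list of distances, and index \<open>k - 1\<close> still falls among them.\<close>

lemma kth_nn_dist_eqI:
  assumes "finite P" "S \<subseteq> P" "card S = k" "1 \<le> k"
    and "\<And>p. p \<in> S \<Longrightarrow> \<delta> q p = r" and "\<And>p. p \<in> P - S \<Longrightarrow> r \<le> \<delta> q p"
  shows "kth_nn_dist \<delta> k P q = r"
proof -
  let ?M = "image_mset (\<delta> q) (mset_set (P - S))"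
  let ?xs = "replicate k r @ sorted_list_of_multiset ?M"
  have "finite S" using assms finite_subset by blast
  have "mset_set P = mset_set S + mset_set (P - S)"
    using assms \<open>finite S\<close> by (subst mset_set_Union[symmetric]) (auto simp: Un_absorb1)
  moreover have "image_mset (\<delta> q) (mset_set S) = image_mset (\<lambda>_. r) (mset_set S)"
    using assms \<open>finite S\<close> by (intro image_mset_cong) auto
  ultimately have "image_mset (\<delta> q) (mset_set P) = mset ?xs"
    using assms by (simp add: image_mset_const_eq)
  moreover have "sorted ?xs"
    using assms by (auto simp: sorted_append)
  ultimately have "sorted_list_of_multiset (image_mset (\<delta> q) (mset_set P)) = ?xs"
    by (metis sorted_list_of_multiset_mset sorted_sort_id)
  then show ?thesis
    using assms(4) by (simp add: kth_nn_dist_def nth_append)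
qed

text \<open>As \<open>r \<le> c * r\<close>, the points outside \<open>S\<close> are also farther
  than \<open>r\<close>, which is therefore the \<open>k\<close>-th distance. An answer must then
  stay inside \<open>S\<close>, which has just \<open>k\<close> points.\<close>

lemma nn_answer_unique:
  assumes "finite P" "S \<subseteq> P" "card S = k" "1 \<le> k" "1 \<le> c" "0 \<le> r"
    and eq: "\<And>p. p \<in> S \<Longrightarrow> \<delta> q p = r" and far: "\<And>p. p \<in> P - S \<Longrightarrow> c * r < \<delta> q p"
    and A: "nn_answer \<delta> c k P q A"
  shows "A = S"
proof -
  have "r \<le> c * r" using assms by (simp add: mult_le_cancel_right1)
  then have "kth_nn_dist \<delta> k P q = r"
    using assms by (intro kth_nn_dist_eqI[of P S]) force+
  then have "A \<subseteq> S" "card A = k"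
    using A far unfolding nn_answer_def by force+
  then show ?thesis
    using assms by (metis card_subset_eq finite_subset)
qed

lemma query_time_leD:
  assumes "query_time \<delta> c k P \<B> q \<le> enat t"
  obtains S A where "S \<subseteq> \<B>" "finite S" "card S \<le> t" "nn_answer \<delta> c k P q A" "A \<subseteq> \<Union>S"
proof -
  let ?X = "{enat (card S) | S. S \<subseteq> \<B> \<and> finite S \<and> (\<exists>A. nn_answer \<delta> c k P q A \<and> A \<subseteq> \<Union> S)}"
  have le: "Inf ?X \<le> enat t" using assms unfolding query_time_def .
  \<comment> \<open>In \<open>enat\<close> the infimum of the empty set is infinity, so the finite
    bound excludes that case; by well-ordering the infimum is then attained.\<close>
  then have "?X \<noteq> {}" by (metis Inf_enat_def enat_ord_simps(5) infinity_ileE)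
  then have "Inf ?X \<in> ?X" by (metis (no_types, lifting) Inf_enat_def LeastI_ex ex_in_conv)
  then obtain S A where "S \<subseteq> \<B>" "finite S" "nn_answer \<delta> c k P q A" "A \<subseteq> \<Union>S" "Inf ?X = enat (card S)"
    by auto
  with le that show thesis by (metis enat_ord_simps(1))
qed

section \<open>Counting the transversals covered by few blocks\<close>

text \<open>The transversals inside \<open>U\<close> form a product of index sets
  \<open>V i\<close>. As the points are distinct, the sizes of these sets add up to at most
  \<open>card U\<close>, and AM-GM bounds their product.\<close>

lemma card_transversals_le:
  fixes a :: "nat \<Rightarrow> nat \<Rightarrow> 'a"
  assumes "1 \<le> k" "finite U"
    and inj: "inj_on (\<lambda>(i, j). a i j) ({..<k} \<times> {..<m})"
  shows "real (card {f \<in> {..<k} \<rightarrow>\<^sub>E {..<m}. \<forall>i<k. a i (f i) \<in> U}) \<le> (real (card U) / real k) ^ k"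
proof -
  define V where "V i = {j. j < m \<and> a i j \<in> U}" for i
  have fin: "finite (V i)" for i by (simp add: V_def)
  have "{f \<in> {..<k} \<rightarrow>\<^sub>E {..<m}. \<forall>i<k. a i (f i) \<in> U} = (\<Pi>\<^sub>E i\<in>{..<k}. V i)"
    by (intro set_eqI) (simp add: V_def PiE_iff, blast)
  then have eq: "real (card {f \<in> {..<k} \<rightarrow>\<^sub>E {..<m}. \<forall>i<k. a i (f i) \<in> U}) = (\<Prod>i<k. real (card (V i)))"
    by (simp add: card_PiE)
  have "(\<Sum>i<k. card (V i)) = card (Sigma {..<k} V)"
    by (simp add: fin card_SigmaI)
  also have "\<dots> = card ((\<lambda>(i, j). a i j) ` Sigma {..<k} V)"
    by (rule card_image[symmetric], rule inj_on_subset[OF inj]) (auto simp: V_def)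
  also have "\<dots> \<le> card U"
    by (rule card_mono) (use assms in \<open>auto simp: V_def\<close>)
  finally have sum: "(\<Sum>i<k. real (card (V i))) \<le> real (card U)"
    by (simp flip: of_nat_sum)
  have "root k (\<Prod>i<k. real (card (V i))) \<le> (\<Sum>i<k. real (card (V i)) / real k)"
  \<comment> \<open>\<open>root\<close> is turned into a real power only for a positive radicand, so
    the case of an empty \<open>V i\<close> is treated apart.\<close>
  proof (cases "(\<Prod>i<k. real (card (V i))) = 0")
    case True
    have "0 \<le> (\<Sum>i<k. real (card (V i)) / real k)" by (intro sum_nonneg) simp
    then show ?thesis by (simp only: True real_root_zero)
  next
    case False
    moreover have "0 \<le> (\<Prod>i<k. real (card (V i)))" by (intro prod_nonneg) simp
    ultimately have "0 < (\<Prod>i<k. real (card (V i)))" by linarith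
    then show ?thesis
      using arith_geom_mean[of "{..<k}" "\<lambda>i. real (card (V i))"] assms(1)
      by (auto simp: lessThan_empty_iff root_powr_inverse)
  qed
  also have "\<dots> \<le> real (card U) / real k"
    using sum assms(1) by (simp add: divide_right_mono flip: sum_divide_distrib)
  finally have "root k (\<Prod>i<k. real (card (V i))) ^ k \<le> (real (card U) / real k) ^ k"
    using assms(1) by (intro power_mono) (auto intro!: real_root_ge_zero prod_nonneg)
  then show ?thesis
    using assms(1) eq by (simp add: real_root_pow_pos2 prod_nonneg)
qed

text \<open>Padding by repetition turns each nonempty choice of at most \<open>t\<close> blocks into
  a list of length exactly \<open>t\<close>, and the number of such lists is a plain power.\<close>

lemma finite_set_as_list_of_length:
  assumes "finite S" "S \<noteq> {}" "card S \<le> t"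
  obtains bs where "set bs = S" "length bs = t"
proof -
  obtain xs where xs: "set xs = S" "length xs = card S"
    using \<open>finite S\<close> by (metis finite_distinct_list distinct_card)
  obtain b where "b \<in> S" using assms by auto
  show thesis
    by (rule that[of "xs @ replicate (t - card S) b"]) (use xs \<open>b \<in> S\<close> assms in auto)
qed

text \<open>Union bound over the \<open>card \<B> ^ t\<close> lists of \<open>t\<close> blocks: each
  union has at most \<open>t * B\<close> points, so the AM-GM bound applies to it.\<close>

lemma transversal_cover_bound:
  fixes a :: "nat \<Rightarrow> nat \<Rightarrow> 'a"
  assumes "1 \<le> k" "finite \<B>" "\<And>b. b \<in> \<B> \<Longrightarrow> finite b \<and> card b \<le> B"
    and inj: "inj_on (\<lambda>(i, j). a i j) ({..<k} \<times> {..<m})"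
    and cover: "\<And>f. f \<in> {..<k} \<rightarrow>\<^sub>E {..<m} \<Longrightarrow>
      \<exists>S\<subseteq>\<B>. card S \<le> t \<and> (\<forall>i<k. a i (f i) \<in> \<Union>S)"
  shows "real m ^ k \<le> real (card \<B>) ^ t * (real (t * B) / real k) ^ k"
proof -
  let ?F = "{..<k} \<rightarrow>\<^sub>E {..<m}"
  let ?L = "{bs. set bs \<subseteq> \<B> \<and> length bs = t}"
  let ?G = "\<lambda>U. {f \<in> ?F. \<forall>i<k. a i (f i) \<in> U}"
  have finL: "finite ?L" using \<open>finite \<B>\<close> by (rule finite_lists_length_eq)
  have finF: "finite ?F" by (simp add: finite_PiE)
  have "?F \<subseteq> (\<Union>bs\<in>?L. ?G (\<Union>(set bs)))"
  proof
    fix f assume f: "f \<in> ?F"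
    then obtain S where S: "S \<subseteq> \<B>" "card S \<le> t" "\<forall>i<k. a i (f i) \<in> \<Union>S"
      using cover[OF f] by (elim exE conjE)
    have "finite S" using S \<open>finite \<B>\<close> finite_subset by blast
    \<comment> \<open>As \<open>1 \<le> k\<close>, the point of group 0 lies in some block, which
      can serve as padding.\<close>
    moreover have "S \<noteq> {}" using S(3) \<open>1 \<le> k\<close> by force
    ultimately obtain bs where "set bs = S" "length bs = t"
      using S finite_set_as_list_of_length by metis
    then show "f \<in> (\<Union>bs\<in>?L. ?G (\<Union>(set bs)))" using f S by auto
  qed
  then have "card ?F \<le> card (\<Union>bs\<in>?L. ?G (\<Union>(set bs)))"
    using finL finF by (intro card_mono) auto
  also have "\<dots> \<le> (\<Sum>bs\<in>?L. card (?G (\<Union>(set bs))))"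
    by (rule card_UN_le) (rule finL)
  finally have "real (card ?F) \<le> (\<Sum>bs\<in>?L. real (card (?G (\<Union>(set bs)))))"
    by (simp flip: of_nat_sum)
  also have "\<dots> \<le> (\<Sum>bs\<in>?L. (real (t * B) / real k) ^ k)"
  proof (rule sum_mono)
    fix bs assume bs: "bs \<in> ?L"
    have "card (\<Union>b\<in>set bs. b) \<le> (\<Sum>b\<in>set bs. card b)"
      by (rule card_UN_le) simp
    also have "\<dots> \<le> (\<Sum>b\<in>set bs. B)"
      using bs assms(3) by (intro sum_mono) auto
    also have "\<dots> \<le> t * B"
      using bs card_length[of bs] by (auto intro: mult_right_mono)
    finally have "real (card (\<Union>(set bs))) \<le> real (t * B)"
      by (simp only: of_nat_le_iff image_ident)
    then have "(real (card (\<Union>(set bs))) / real k) ^ k \<le> (real (t * B) / real k) ^ k"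
      by (intro power_mono divide_right_mono) auto
    moreover have "finite (\<Union>(set bs))" using bs assms(3) by auto
    ultimately show "real (card (?G (\<Union>(set bs)))) \<le> (real (t * B) / real k) ^ k"
      using card_transversals_le[OF \<open>1 \<le> k\<close> _ inj] order_trans by blast
  qed
  also have "\<dots> = real (card \<B>) ^ t * (real (t * B) / real k) ^ k"
    using \<open>finite \<B>\<close> by (simp add: card_lists_length_eq)
  finally show ?thesis by (simp add: card_PiE)
qed

section \<open>The hard point set and its queries\<close>

text \<open>If \<open>k\<close> does not divide \<open>n\<close>, some groups receive an extra point
  of index \<open>n div k\<close>, whence the strict bound \<open>n div k < 2 ^ s\<close>.
  Transversals use only the first \<open>n div k\<close> points, which every group has.\<close>

lemma hard_instance:
  fixes c :: real
  assumes "1 \<le> k" "k \<le> n" "1 < c" "c < 1 + 1 / (4 * real k)"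
    and s: "1 \<le> s" "n div k < 2 ^ s" and d: "k * (16 * s) \<le> d"
  obtains P and a :: "nat \<Rightarrow> nat \<Rightarrow> bool list" where
    "P \<in> point_sets n d"
    "inj_on (\<lambda>(i, j). a i j) ({..<k} \<times> {..<n div k})"
    "\<And>f. f \<in> {..<k} \<rightarrow>\<^sub>E {..<n div k} \<Longrightarrow>
      \<exists>q\<in>cube d. \<forall>A. nn_answer hamming c k P q A \<longrightarrow> A = (\<lambda>i. a i (f i)) ` {..<k}"
proof -
  let ?D = "16 * s" and ?N = "2 ^ s :: nat"
  obtain E :: "nat \<Rightarrow> nat set" where E_sub: "\<And>j. j < ?N \<Longrightarrow> E j \<subseteq> {..<?D}"
    and E_card: "\<And>j. j < ?N \<Longrightarrow> card (E j) = 8 * s"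
    and E_dist: "\<And>i j. i < ?N \<Longrightarrow> j < ?N \<Longrightarrow> i \<noteq> j \<Longrightarrow> 2 * s \<le> card (sym_diff (E i) (E j))"
    using constant_weight_code[of s] by blast
  have E_fin: "finite (E j)" if "j < ?N" for j
    using E_sub[OF that] finite_subset by blast
  have E_ne: "E j \<noteq> {}" if "j < ?N" for j
    using E_card[OF that] s by auto
  define a where "a i j = segment_word d ?D ({i} \<times> E j)" for i j
  have box: "{i} \<times> E j \<subseteq> {..<k} \<times> {..<?D}" if "i < k" "j < ?N" for i j
    using that E_sub[OF that(2)] by auto
  have inj: "inj_on (\<lambda>(i, j). a i j) ({..<k} \<times> {..<?N})"
  proof (rule inj_onI, clarify)
    fix i j i' j' assume a: "a i j = a i' j'" and ij: "i < k" "j < ?N" "i' < k" "j' < ?N"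
    \<comment> \<open>Equal words have distance zero, so the underlying sets agree. Nonempty
      codewords then reveal the group, and the positive code distance reveals the index.\<close>
    have "real (card (sym_diff ({i} \<times> E j) ({i'} \<times> E j'))) = hamming (a i j) (a i' j')"
      unfolding a_def using ij box d by (intro hamming_segment_word[symmetric, of _ k]) auto
    also have "\<dots> = 0" using a by (simp add: hamming_def)
    finally have "sym_diff ({i} \<times> E j) ({i'} \<times> E j') = {}"
      using E_fin ij by simp
    then have eq: "{i} \<times> E j = {i'} \<times> E j'" by blast
    then have "i = i'" "E j = E j'" using E_ne ij by blast+
    then show "i = i' \<and> j = j'" using E_dist[of j j'] ij s by force
  qed
  \<comment> \<open>Dealing the \<open>n\<close> points out to the \<open>k\<close> groups in turn avoids leftover points when \<open>k\<close> does
    not divide \<open>n\<close>.\<close>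
  define pt where "pt p = a (p mod k) (p div k)" for p
  define P where "P = pt ` {..<n}"
  have p_range: "p mod k < k" "p div k < ?N" if "p < n" for p
    using \<open>1 \<le> k\<close> s(2) div_le_mono[of p n k] that by auto
  have "inj_on pt {..<n}"
  proof (rule inj_onI)
    fix p p' assume "p \<in> {..<n}" "p' \<in> {..<n}" "pt p = pt p'"
    then have "p mod k = p' mod k \<and> p div k = p' div k"
      using inj_onD[OF inj, of "(p mod k, p div k)" "(p' mod k, p' div k)"] p_range
      by (auto simp: pt_def)
    then show "p = p'" by (metis div_mult_mod_eq)
  qed
  then have cardP: "card P = n" by (simp add: P_def card_image)
  have finP: "finite P" by (simp add: P_def)
  show thesis
  proof (rule that[of P a])
    show "P \<in> point_sets n d"
      using cardP by (auto simp: point_sets_def P_def pt_def a_def segment_word_in_cube)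
    show "inj_on (\<lambda>(i, j). a i j) ({..<k} \<times> {..<n div k})"
      by (rule inj_on_subset[OF inj]) (use s in auto)
  next
    fix f assume f: "f \<in> {..<k} \<rightarrow>\<^sub>E {..<n div k}"
    have f_less: "f i < n div k" "f i < ?N" if "i < k" for i
    proof -
      show "f i < n div k" using f that by auto
      then show "f i < ?N" using s(2) by (rule less_trans)
    qed
    define T where "T = Sigma {..<k} (\<lambda>i. E (f i))"
    define q where "q = segment_word d ?D T"
    let ?S = "(\<lambda>i. a i (f i)) ` {..<k}"
    have T_box: "T \<subseteq> {..<k} \<times> {..<?D}"
      using E_sub f_less unfolding T_def by fastforce
    \<comment> \<open>Every segment other than \<open>i\<close> contributes its weight
      \<open>8 * s\<close>, as the point is zero there; segment \<open>i\<close> contributes the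
      code distance.\<close>
    have dist: "hamming q (a i j) = real ((k - 1) * (8 * s) + card (sym_diff (E (f i)) (E j)))"
      if ij: "i < k" "j < ?N" for i j
    proof -
      let ?g = "\<lambda>l. if l = i then sym_diff (E (f i)) (E j) else E (f l)"
      have fin: "finite (?g l)" if "l < k" for l
        using that ij f_less E_fin by auto
      have "sym_diff T ({i} \<times> E j) = Sigma {..<k} ?g"
        using ij by (auto simp: T_def split: if_splits)
      then have "card (sym_diff T ({i} \<times> E j)) = (\<Sum>l<k. card (?g l))"
        using fin by (simp add: card_SigmaI del: if_image_distrib)
      also have "\<dots> = card (?g i) + (\<Sum>l\<in>{..<k} - {i}. card (?g l))"
        using ij by (intro sum.remove) auto
      also have "(\<Sum>l\<in>{..<k} - {i}. card (?g l)) = (\<Sum>l\<in>{..<k} - {i}. 8 * s)"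
        using f_less E_card by (intro sum.cong) auto
      also have "\<dots> = (k - 1) * (8 * s)" using ij by simp
      finally show ?thesis
        unfolding q_def a_def
        using hamming_segment_word[OF T_box box[OF ij] d] by simp
    qed
    let ?r = "real ((k - 1) * (8 * s))"
    \<comment> \<open>The bound on \<open>c\<close> enters here:
      \<open>(k - 1) * 8 * s / (4 * k) < 2 * s\<close>, so the factor \<open>c\<close> cannot bridge
      the minimum distance of the code.\<close>
    have "(c - 1) * ?r \<le> 1 / (4 * real k) * ?r"
      using assms by (intro mult_right_mono) auto
    also have "\<dots> < 2 * real s"
      using assms by (simp add: field_simps of_nat_diff)
    finally have gap: "c * ?r < ?r + 2 * real s" by (simp add: algebra_simps)
    have "A = ?S" if A: "nn_answer hamming c k P q A" for A
    proof (rule nn_answer_unique[OF finP _ _ \<open>1 \<le> k\<close> _ _ _ _ A, of _ ?r])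
      show "?S \<subseteq> P"
      proof clarify
        fix i assume i: "i < k"
        \<comment> \<open>Point \<open>f i\<close> of group \<open>i\<close> is dealt out as number
          \<open>f i * k + i\<close>.\<close>
        have "f i * k + i < Suc (f i) * k" using i by simp
        also have "\<dots> \<le> (n div k) * k"
          using f_less(1)[OF i] by (intro mult_right_mono) auto
        also have "\<dots> \<le> n" by simp
        finally have "f i * k + i < n" .
        moreover have "pt (f i * k + i) = a i (f i)" using i by (simp add: pt_def)
        ultimately show "a i (f i) \<in> P" unfolding P_def by (metis imageI lessThan_iff)
      qed
      have "inj_on (\<lambda>i. a i (f i)) {..<k}"
        using inj f_less by (fastforce simp: inj_on_def)
      then show "card ?S = k" by (simp add: card_image)
      show "1 \<le> c" using assms by simp
      show "0 \<le> ?r" by simp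
    next
      fix p assume "p \<in> ?S"
      then show "hamming q p = ?r" using dist f_less by auto
    next
      fix p assume p: "p \<in> P - ?S"
      then obtain l where l: "l < n" "p = pt l" by (auto simp: P_def)
      let ?i = "l mod k" and ?j = "l div k"
      \<comment> \<open>A point off the transversal differs from the query's codeword in its own
        segment, which costs at least \<open>2 * s\<close> more.\<close>
      have "?j \<noteq> f ?i" using p l p_range by (auto simp: pt_def)
      then have "2 * s \<le> card (sym_diff (E (f ?i)) (E ?j))"
        using p_range[OF l(1)] f_less by (intro E_dist) auto
      then have "?r + 2 * real s \<le> hamming q p"
        using dist[OF p_range[OF l(1)]] l by (simp add: pt_def)
      then show "c * ?r < hamming q p" using gap by simp
    qed
    then show "\<exists>q\<in>cube d. \<forall>A. nn_answer hamming c k P q A \<longrightarrow> A = ?S"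
      using segment_word_in_cube[of d ?D T] unfolding q_def by blast
  qed
qed

section \<open>From the count to the space bound\<close>

text \<open>Rounding \<open>k / \<alpha>\<close> up and \<open>n / k\<close> down costs a factor 2
  each, so \<open>y ^ k \<le> M ^ t\<close> where \<open>y\<close> is a quarter of the ratio under
  the root. Taking \<open>t\<close>-th roots with \<open>\<alpha> / 2 \<le> k / t\<close> bounds
  \<open>sqrt y powr \<alpha>\<close>.\<close>

lemma space_bound_from_count:
  fixes \<alpha> :: real
  assumes "1 \<le> k" "k \<le> n" "1 \<le> \<alpha>" "\<alpha> \<le> real B" "\<alpha> \<le> 2 * real k" "1 \<le> M"
    and t: "t = nat \<lceil>real k / \<alpha>\<rceil>"
    and count: "real (n div k) ^ k \<le> real M ^ t * (real (t * B) / real k) ^ k"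
  shows "(1 / (2 * exp 1) * sqrt (real n * \<alpha> / (real k * real B))) powr \<alpha> \<le> real M"
proof -
  define y where "y = real n * \<alpha> / (4 * real k * real B)"
  have pos: "0 < real k" "0 < \<alpha>" "0 < real B" "0 < real n" using assms by linarith+
  then have "0 < y" by (simp add: y_def)
  have "0 < real k / \<alpha>" using pos by simp
  then have "1 \<le> t" unfolding t by linarith
  \<comment> \<open>For \<open>\<alpha> \<le> k\<close> a number that is at least 1 is rounded up,
    which at most doubles it; otherwise \<open>t = 1\<close>, and the bound amounts to
    \<open>\<alpha> \<le> 2 * k\<close>.\<close>
  have t_le: "real t \<le> 2 * real k / \<alpha>"
  proof (cases "\<alpha> \<le> real k")
    case True
    have "real t \<le> real k / \<alpha> + 1" unfolding t using pos by simp
    moreover have "1 \<le> real k / \<alpha>" using True pos by simp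
    ultimately show ?thesis by simp
  next
    case False
    then have "real k / \<alpha> \<le> 1" using pos by simp
    then have "\<lceil>real k / \<alpha>\<rceil> \<le> 1" by (simp add: ceiling_le_iff)
    then have "real t \<le> 1" unfolding t by linarith
    also have "1 \<le> 2 * real k / \<alpha>" using assms pos by simp
    finally show ?thesis .
  qed
  \<comment> \<open>As \<open>n div k\<close> is at least 1, it exceeds half of
    \<open>n / k\<close>.\<close>
  have "n < Suc (n div k) * k" using \<open>1 \<le> k\<close> by (simp add: dividend_less_div_times)
  moreover have "1 \<le> n div k" using assms by (simp add: Suc_le_eq div_greater_zero_iff)
  then have "Suc (n div k) * k \<le> 2 * (n div k) * k" by (intro mult_right_mono) auto
  ultimately have "n \<le> 2 * (n div k) * k" by linarith
  then have n_le: "real n \<le> 2 * real (n div k) * real k"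
    by (metis of_nat_le_iff of_nat_mult of_nat_numeral)
  have "y * (real (t * B) / real k) = real n * (real t * \<alpha>) / (4 * real k * real k)"
    using pos by (simp add: y_def)
  also have "\<dots> \<le> real n * (2 * real k) / (4 * real k * real k)"
    using t_le pos by (intro divide_right_mono mult_left_mono) (auto simp: field_simps)
  also have "\<dots> = real n / (2 * real k)" using pos by simp
  also have "\<dots> \<le> real (n div k)" using n_le pos by (simp add: field_simps)
  finally have "(y * (real (t * B) / real k)) ^ k \<le> real (n div k) ^ k"
    using \<open>0 < y\<close> by (intro power_mono) auto
  also note count
  finally have "y ^ k * (real (t * B) / real k) ^ k \<le> real M ^ t * (real (t * B) / real k) ^ k"
    by (simp only: power_mult_distrib)
  moreover have "0 < (real (t * B) / real k) ^ k" using pos \<open>1 \<le> t\<close> by simp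
  ultimately have yM: "y ^ k \<le> real M ^ t" by (simp only: mult_le_cancel_right_pos)
  have "real n * \<alpha> / (real k * real B) = 4 * y" using pos by (simp add: y_def)
  then have base: "1 / (2 * exp 1) * sqrt (real n * \<alpha> / (real k * real B)) = sqrt y / exp 1"
    by (simp add: real_sqrt_mult)
  have "sqrt y / exp 1 \<le> sqrt y / 1"
    using \<open>0 < y\<close> by (intro divide_left_mono) auto
  then have base_le: "(sqrt y / exp 1) powr \<alpha> \<le> sqrt y powr \<alpha>"
    using \<open>0 < y\<close> pos by (intro powr_mono2) auto
  have "sqrt y powr \<alpha> \<le> real M"
  \<comment> \<open>Raising the exponent from \<open>\<alpha> / 2\<close> to \<open>k / t\<close>
    requires a base of at least 1; for smaller \<open>y\<close> the power is at most 1, hence at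
    most \<open>M\<close>.\<close>
  proof (cases "y < 1")
    case True
    then have "sqrt y powr \<alpha> \<le> 1" using \<open>0 < y\<close> pos by (intro powr_le1) auto
    then show ?thesis using \<open>1 \<le> M\<close> by simp
  next
    case False
    have "sqrt y powr \<alpha> = y powr (\<alpha> / 2)"
      using \<open>0 < y\<close> by (simp add: powr_half_sqrt[symmetric] powr_powr)
    also have "\<dots> \<le> y powr (real k / real t)"
      using False t_le pos \<open>1 \<le> t\<close> by (intro powr_mono) (auto simp: field_simps)
    also have "\<dots> = (y ^ k) powr (1 / real t)"
      using \<open>0 < y\<close> by (simp add: powr_powr flip: powr_realpow)
    also have "\<dots> \<le> (real M ^ t) powr (1 / real t)"
      using yM \<open>0 < y\<close> by (intro powr_mono2) auto
    also have "\<dots> = real M"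
      using \<open>1 \<le> M\<close> \<open>1 \<le> t\<close> by (simp add: powr_powr flip: powr_realpow)
    finally show ?thesis .
  qed
  with base_le base show ?thesis by simp
qed

text \<open>Since each transversal query on the hard set has only one answer, the blocks read for it
  must cover the whole transversal, as the counting bound demands.\<close>

lemma indexing_scheme_space_bound:
  fixes c \<alpha> :: real
  assumes "1 \<le> k" "k \<le> n" "1 < c" "c < 1 + 1 / (4 * real k)"
    and "1 \<le> \<alpha>" "\<alpha> \<le> real B" "\<alpha> \<le> 2 * real k"
    and "1 \<le> s" "n div k < 2 ^ s" "k * (16 * s) \<le> d"
    and I: "hamming_indexing_scheme n d c k B (nat \<lceil>real k / \<alpha>\<rceil>) I"
  shows "\<exists>P\<in>point_sets n d.
    (1 / (2 * exp 1) * sqrt (real n * \<alpha> / (real k * real B))) powr \<alpha> \<le> real (card (I P))"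
proof -
  define t where "t = nat \<lceil>real k / \<alpha>\<rceil>"
  obtain P and a :: "nat \<Rightarrow> nat \<Rightarrow> bool list" where P: "P \<in> point_sets n d"
    and inj: "inj_on (\<lambda>(i, j). a i j) ({..<k} \<times> {..<n div k})"
    and uniq: "\<And>f. f \<in> {..<k} \<rightarrow>\<^sub>E {..<n div k} \<Longrightarrow>
      \<exists>q\<in>cube d. \<forall>A. nn_answer hamming c k P q A \<longrightarrow> A = (\<lambda>i. a i (f i)) ` {..<k}"
    using hard_instance[of k n c s d] assms by blast
  \<comment> \<open>Infinite sets have cardinality 0, so \<open>card P = n\<close> with positive
    \<open>n\<close> forces finiteness.\<close>
  have "finite P" using P assms by (auto simp: point_sets_def intro: card_ge_0_finite)
  have blocks: "b \<subseteq> P" "card b \<le> B" if "b \<in> I P" for b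
    using I P that by (auto simp: hamming_indexing_scheme_def block_collection_def)
  then have "finite (I P)" using \<open>finite P\<close> by (meson PowI finite_Pow_iff finite_subset subsetI)
  have cover: "\<exists>S\<subseteq>I P. card S \<le> t \<and> (\<forall>i<k. a i (f i) \<in> \<Union>S)"
    if f: "f \<in> {..<k} \<rightarrow>\<^sub>E {..<n div k}" for f
  proof -
    obtain q where q: "q \<in> cube d"
      "\<And>A. nn_answer hamming c k P q A \<Longrightarrow> A = (\<lambda>i. a i (f i)) ` {..<k}"
      using uniq[OF f] by blast
    have "worst_query_time hamming (cube d) c k P (I P) \<le> enat t"
      using I P by (simp add: hamming_indexing_scheme_def t_def)
    then have "query_time hamming c k P (I P) q \<le> enat t"
      unfolding worst_query_time_def using q(1) by (meson SUP_le_iff)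
    then obtain S A where "S \<subseteq> I P" "card S \<le> t" "nn_answer hamming c k P q A" "A \<subseteq> \<Union>S"
      by (rule query_time_leD)
    then show ?thesis using q(2) by blast
  qed
  have count: "real (n div k) ^ k \<le> real (card (I P)) ^ t * (real (t * B) / real k) ^ k"
    using assms(1) \<open>finite (I P)\<close> _ inj cover
    by (rule transversal_cover_bound) (use blocks \<open>finite P\<close> finite_subset in blast)
  \<comment> \<open>Some transversal exists, and covering it takes at least one block.\<close>
  have "0 < n div k" using assms by (simp add: div_greater_zero_iff)
  then have "(\<lambda>i\<in>{..<k}. 0) \<in> {..<k} \<rightarrow>\<^sub>E {..<n div k}" by auto
  from cover[OF this] have "I P \<noteq> {}" using \<open>1 \<le> k\<close> by force
  then have "1 \<le> card (I P)" using \<open>finite (I P)\<close> by (simp add: Suc_le_eq card_gt_0_iff)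
  with space_bound_from_count[OF assms(1,2,5-7) _ t_def count] P show ?thesis by blast
qed

theorem theorem3:
  "\<exists>C>0. \<exists>\<gamma>>0. \<forall>(n::nat) (k::nat) (c::real) (B::nat) (\<alpha>::real).
     1 \<le> k \<and> k \<le> n \<and> 1 < c \<and> c < 1 + 1 / (4 * real k) \<and>
     1 \<le> \<alpha> \<and> \<alpha> \<le> real B \<and> \<alpha> \<le> 2 * real k \<longrightarrow>
     (\<exists>d0::nat. real d0 \<le> C * (real k * max 1 (log 2 (real n / real k))) \<and>
        (\<forall>d\<ge>d0. \<forall>I.
           hamming_indexing_scheme n d c k B (nat \<lceil>real k / \<alpha>\<rceil>) I \<longrightarrow>
           (\<exists>P\<in>point_sets n d.
              real (card (I P)) \<ge>
                \<gamma> * (1 / (2 * exp 1) * sqrt (real n * \<alpha> / (real k * real B))) powr \<alpha>)))"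
proof (rule exI[of _ 48], rule conjI, simp, rule exI[of _ 1], rule conjI, simp, intro allI impI, elim conjE)
  fix n k B :: nat and c \<alpha> :: real
  assume a: "1 \<le> k" "k \<le> n" "1 < c" "c < 1 + 1 / (4 * real k)"
    "1 \<le> \<alpha>" "\<alpha> \<le> real B" "\<alpha> \<le> 2 * real k"
  define l where "l = log 2 (real n / real k)"
  \<comment> \<open>The summand 1 makes \<open>2 ^ s\<close> strictly exceed \<open>n / k\<close>.
    Since \<open>s < l + 2 \<le> 3 * max 1 l\<close> and segments have length \<open>16 * s\<close>,
    the constant is \<open>48 = 16 * 3\<close>.\<close>
  define s where "s = nat \<lceil>l\<rceil> + 1"
  have ratio: "1 \<le> real n / real k" using a by simp
  then have "0 \<le> l" unfolding l_def by simp
  then have s_le: "real s \<le> 3 * max 1 l" and l_le: "l + 1 \<le> real s"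
    unfolding s_def by linarith+
  have "real (n div k) \<le> real n / real k" by (rule of_nat_div_le_of_nat)
  also have "\<dots> < 2 * (real n / real k)" using ratio by simp
  also have "\<dots> = 2 powr (l + 1)" using ratio by (simp add: l_def powr_add)
  also have "\<dots> \<le> 2 powr real s" using l_le by simp
  also have "\<dots> = real (2 ^ s)" by (simp add: powr_realpow)
  finally have "n div k < 2 ^ s" by (simp only: of_nat_less_iff)
  moreover have "1 \<le> s" by (simp add: s_def)
  moreover have "real (k * (16 * s)) \<le> 48 * (real k * max 1 l)"
    using mult_left_mono[OF s_le, of "16 * real k"] by (simp add: mult_ac)
  ultimately show "\<exists>d0::nat. real d0 \<le> 48 * (real k * max 1 (log 2 (real n / real k))) \<and>
        (\<forall>d\<ge>d0. \<forall>I.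
           hamming_indexing_scheme n d c k B (nat \<lceil>real k / \<alpha>\<rceil>) I \<longrightarrow>
           (\<exists>P\<in>point_sets n d.
              1 * (1 / (2 * exp 1) * sqrt (real n * \<alpha> / (real k * real B))) powr \<alpha>
              \<le> real (card (I P))))"
    using indexing_scheme_space_bound[OF a] unfolding l_def mult_1
    by (intro exI[of _ "k * (16 * s)"]) blast
qed

end
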